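(* Let $\mathcal H$ be the Hecke algebra of $G_4$ with basis $B_{sts}$. An $R$-basis for the centralizer $Z_{\mathcal H}(\tilde T_t)$ of $\tilde T_t$ in $\mathcal H$ is the set consisting of the following twelve elements: (1) $\tilde T_1$; (2) $\tilde T_{st^2s}$; (3) $\tilde T_t$; (4) $\tilde T_{s^2ts^2}$; (5) $\tilde T_{t^2}$; (6) $\tilde T_{ststst}$; (7) $\tilde T_s+\tilde T_{sts^2}+\tilde T_{s^2ts}-\xi_2\tilde T_{sts}$; (8) $\tilde T_{ts}+\tilde T_{st}+\tilde T_{t^2st^2}+\xi_1\tilde T_{sts}$; (9) $\tilde T_{t^2s}+\tilde T_{st^2}+\tilde T_{sts}+\xi_1\tilde T_{sts^2}+\xi_1\tilde T_{s^2ts}+\xi_2\tilde T_{t^2st^2}$; (10) $\tilde T_{s^2}+\tilde T_{st^2s^2}+\tilde T_{s^2t^2s}+\xi_1\tilde T_{sts}+\xi_2\tilde T_{ts^2t}+\xi_1\xi_2\tilde T_{t^2st^2}+\xi_1(\tilde T_{s^2t}+\tilde T_{ts^2})+\xi_1^2(\tilde T_{sts^2}+\tilde T_{s^2ts})$; (11) $\tilde T_{ts^2}+\tilde T_{s^2t}+\tilde T_{s^2t^2s^2}+\xi_1\xi_2(\tilde T_{s^2t}+\tilde T_{ts^2})+(\xi_1+\xi_2^2)\tilde T_{ts^2t}+\xi_2(1+\xi_1\xi_2)\tilde T_{t^2st^2}+\xi_1(1+\xi_1\xi_2)(\tilde T_{sts^2}+\tilde T_{s^2ts})$; (12) $\tilde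 T_{t^2s^2}+\tilde T_{s^2t^2}+\tilde T_{ts^2t}+\xi_1\xi_2\tilde T_{ts^2t}+\xi_1^2\xi_2\tilde T_{t^2st^2}+\xi_1^2\tilde T_{sts}+(\xi_1^2-\xi_2)(\tilde T_{s^2t}+\tilde T_{ts^2})+\xi_1^3(\tilde T_{sts^2}+\tilde T_{s^2ts})+\xi_1(\tilde T_{st^2s^2}+\tilde T_{s^2t^2s})$.
   Context: $G_4=\langle s,t\mid s^3=t^3=1,\ sts=tst\rangle$ (a group of order 24). Let $\xi_1,\xi_2$ be indeterminates and $R=\mathbb Z[\xi_1,\xi_2]$. The Hecke algebra $\mathcal H$ of $G_4$ is the $R$-algebra generated by $\tilde T_s,\tilde T_t$ subject to $\tilde T_s\tilde T_t\tilde T_s=\tilde T_t\tilde T_s\tilde T_t$ and $\tilde T_x^3=1+\xi_1\tilde T_x+\xi_2\tilde T_x^2$ for $x\in\{s,t\}$. For a word $x_1\cdots x_k$ in $s,t$ put $\tilde T_{x_1\cdots x_k}=\tilde T_{x_1}\cdots\tilde T_{x_k}$, $\tilde T_1=1$. $\mathcal H$ is a free $R$-module of rank 24, with $R$-basis $B_{sts}$ consisting of the elements $\tilde T_w$ for the words $w\in\{1,s,t,s^2,t^2,st,ts,st^2,t^2s,s^2t,ts^2,s^2t^2,t^2s^2,st^2s,ts^2t,s^2ts^2,t^2st^2,ststst,sts,sts^2,s^2ts,s^2t^2s,st^2s^2,s^2t^2s^2\}$. *)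

theory Defs
  imports "HOL-Computational_Algebra.Polynomial" "HOL-Library.Poly_Mapping"
begin

text \<open>The base ring \<open>R = \<int>[\<xi>\<^sub>1, \<xi>\<^sub>2]\<close>, represented as \<open>(\<int>[\<xi>\<^sub>1])[\<xi>\<^sub>2]\<close>.\<close>

type_synonym R = "int poly poly"

definition xi1 :: R  (\<open>\<xi>\<^sub>1\<close>) where "\<xi>\<^sub>1 = [:[:0, 1:]:]"
definition xi2 :: R  (\<open>\<xi>\<^sub>2\<close>) where "\<xi>\<^sub>2 = [:0, 1:]"


text \<open>
  The free monoid on the two generators, written additively (\<open>+\<close> is concatenation and \<open>0\<close> is the
  empty word) because multiplication on \<^typ>\<open>'a \<Rightarrow>\<^sub>0 'b\<close> is convolution over an additive monoid.
  Consequently \<open>word \<Rightarrow>\<^sub>0 R\<close> is the free associative unital \<open>R\<close>-algebra on the two generators.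
\<close>

datatype gen = S | T

datatype word = Word (letters: "gen list")

instantiation word :: monoid_add
begin

definition zero_word :: word where "0 = Word []"
definition plus_word :: "word \<Rightarrow> word \<Rightarrow> word" where "v + w = Word (letters v @ letters w)"

instance
  by standard (simp_all add: zero_word_def plus_word_def)

end

type_synonym free_alg = "word \<Rightarrow>\<^sub>0 R"

definition var :: "gen \<Rightarrow> free_alg"
  where "var x = Poly_Mapping.single (Word [x]) 1"

definition const :: "R \<Rightarrow> free_alg"
  where "const r = Poly_Mapping.single 0 r"

lemma const_0 [simp]: "const 0 = 0"
  and const_1 [simp]: "const 1 = 1"
  and const_add: "const (q + r) = const q + const r"
  and const_mult: "const (q * r) = const q * const r"
  by (simp_all add: const_def single_add mult_single)

lemma free_alg_induct [case_names single add]: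
  assumes "\<And>k v. P (Poly_Mapping.single k v)" and "\<And>a b. P a \<Longrightarrow> P b \<Longrightarrow> P (a + b)"
  shows "P (a :: free_alg)"
proof (induction a rule: update_induct)
  case const
  show ?case using assms(1)[of 0 0] by simp
next
  case (update f k v)
  have "Poly_Mapping.update k v f = f + Poly_Mapping.single k v"
    using update.hyps
    by (intro poly_mapping_eqI)
      (auto simp: lookup_update lookup_add lookup_single when_def in_keys_iff)
  then show ?case using assms update.IH by simp
qed

lemma const_central: "const r * a = a * const r"
proof (induction a rule: free_alg_induct)
  case (single k v)
  then show ?case by (simp add: const_def mult_single mult.commute)
next
  case (add a b)
  then show ?case by (simp add: distrib_left distrib_right)
qed


text \<open>The two-sided ideal generated by the braid relation and the two cubic relations.\<close>

inductive_set hecke_ideal :: "free_alg set" where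
  braid: "var S * var T * var S - var T * var S * var T \<in> hecke_ideal"
| cubic: "var x ^ 3 - (1 + const \<xi>\<^sub>1 * var x + const \<xi>\<^sub>2 * var x ^ 2) \<in> hecke_ideal"
| zero: "0 \<in> hecke_ideal"
| add: "a \<in> hecke_ideal \<Longrightarrow> b \<in> hecke_ideal \<Longrightarrow> a + b \<in> hecke_ideal"
| mult_left: "a \<in> hecke_ideal \<Longrightarrow> b * a \<in> hecke_ideal"
| mult_right: "a \<in> hecke_ideal \<Longrightarrow> a * b \<in> hecke_ideal"

lemma hecke_ideal_uminus: "a \<in> hecke_ideal \<Longrightarrow> - a \<in> hecke_ideal"
  using hecke_ideal.mult_left[of a "- 1"] by simp

lemma hecke_ideal_diff: "a \<in> hecke_ideal \<Longrightarrow> b \<in> hecke_ideal \<Longrightarrow> a - b \<in> hecke_ideal"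
  using hecke_ideal.add[of a "- b"] hecke_ideal_uminus[of b] by simp


text \<open>
  The ideal is proper: it is killed by the ring homomorphism to \<open>\<int>\<close> that sends both
  generators to \<open>1\<close> and both indeterminates to \<open>0\<close>.
\<close>

definition aug :: "free_alg \<Rightarrow> int"
  where "aug a = (\<Sum>k\<in>Poly_Mapping.keys a. poly (poly (Poly_Mapping.lookup a k) 0) 0)"

lemma aug_single: "aug (Poly_Mapping.single k r) = poly (poly r 0) 0"
  by (simp add: aug_def)

lemma aug_add: "aug (a + b) = aug a + aug b"
  unfolding aug_def by (rule setsum_keys_plus_distrib) simp_all

lemma aug_0: "aug 0 = 0"
  by (simp add: aug_def)

lemma aug_diff: "aug (a - b) = aug a - aug b"
  using aug_add[of "a - b" b] by simp

lemma aug_mult: "aug (a * b) = aug a * aug b"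
proof (induction a rule: free_alg_induct)
  case (single k v)
  show ?case
    by (induction b rule: free_alg_induct)
      (simp_all add: mult_single aug_single aug_add distrib_left)
next
  case (add a b)
  then show ?case by (simp add: aug_add distrib_right)
qed

lemma aug_hecke_ideal: "a \<in> hecke_ideal \<Longrightarrow> aug a = 0"
proof (induction rule: hecke_ideal.induct)
  case (cubic x)
  have "aug 1 = 1"
    using aug_single[of 0 1] by simp
  then show ?case
    by (simp add: aug_diff aug_add aug_mult aug_single var_def const_def xi1_def xi2_def
        power2_eq_square power3_eq_cube)
qed (simp_all add: aug_diff aug_add aug_mult aug_single aug_0 var_def)

lemma one_notin_hecke_ideal: "1 \<notin> hecke_ideal"
  using aug_hecke_ideal[of 1] aug_single[of 0 1] by auto


text \<open>The Hecke algebra of \<open>G\<^sub>4\<close>: the quotient of the free algebra by this ideal.\<close>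

quotient_type hecke = free_alg / "\<lambda>a b. a - b \<in> hecke_ideal"
proof (rule equivpI)
  show "reflp (\<lambda>a b. a - b \<in> hecke_ideal)"
    by (simp add: reflp_def hecke_ideal.zero)
  show "symp (\<lambda>a b. a - b \<in> hecke_ideal)"
    using hecke_ideal_uminus by (fastforce simp: symp_def)
  show "transp (\<lambda>a b. a - b \<in> hecke_ideal)"
    using hecke_ideal.add by (fastforce simp: transp_def)
qed

instantiation hecke :: ring_1
begin

lift_definition zero_hecke :: hecke is 0 .
lift_definition one_hecke :: hecke is 1 .
lift_definition plus_hecke :: "hecke \<Rightarrow> hecke \<Rightarrow> hecke" is "(+)"
  by (metis add_diff_add hecke_ideal.add)
lift_definition minus_hecke :: "hecke \<Rightarrow> hecke \<Rightarrow> hecke" is "(-)"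
proof -
  fix a a' b b' :: free_alg
  assume "a - a' \<in> hecke_ideal" "b - b' \<in> hecke_ideal"
  then have "(a - a') - (b - b') \<in> hecke_ideal"
    by (rule hecke_ideal_diff)
  then show "a - b - (a' - b') \<in> hecke_ideal"
    by (simp add: algebra_simps)
qed
lift_definition uminus_hecke :: "hecke \<Rightarrow> hecke" is uminus
  by (metis hecke_ideal_uminus minus_diff_minus)
lift_definition times_hecke :: "hecke \<Rightarrow> hecke \<Rightarrow> hecke" is "(*)"
proof -
  fix a a' b b' :: free_alg
  assume "a - a' \<in> hecke_ideal" "b - b' \<in> hecke_ideal"
  then have "(a - a') * b + a' * (b - b') \<in> hecke_ideal"
    by (intro hecke_ideal.intros)
  then show "a * b - a' * b' \<in> hecke_ideal"
    by (simp add: algebra_simps)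
qed

instance
proof
  show "(0 :: hecke) \<noteq> 1"
    by transfer (use one_notin_hecke_ideal hecke_ideal_uminus in fastforce)
qed (transfer; simp add: hecke_ideal.zero algebra_simps)+

end

lift_definition scale :: "R \<Rightarrow> hecke \<Rightarrow> hecke"  (infixr \<open>\<odot>\<close> 75) is "\<lambda>r a. const r * a"
  by (metis hecke_ideal.mult_left right_diff_distrib)

global_interpretation hecke: module scale
  by standard
    (transfer; simp add: const_add const_mult hecke_ideal.zero distrib_left distrib_right mult.assoc)+

lemma scale_mult_left: "(r \<odot> x) * y = r \<odot> (x * y)"
  by transfer (simp add: mult.assoc hecke_ideal.zero)

lemma scale_mult_right: "x * (r \<odot> y) = r \<odot> (x * y)"
proof transfer
  fix a b :: free_alg and r
  have "a * (const r * b) = const r * (a * b)"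
    by (metis const_central mult.assoc)
  then show "a * (const r * b) - const r * (a * b) \<in> hecke_ideal"
    by (simp add: hecke_ideal.zero)
qed


text \<open>\<open>Tw [x\<^sub>1, \<dots>, x\<^sub>k]\<close> is the element written \<open>T\<^sub>w\<close> (with a tilde) for the word \<open>w = x\<^sub>1\<dots>x\<^sub>k\<close>.\<close>

lift_definition T_gen :: "gen \<Rightarrow> hecke" is var .

definition Tw :: "gen list \<Rightarrow> hecke"
  where "Tw w = prod_list (map T_gen w)"

lemma hecke_braid: "Tw [S, T, S] = Tw [T, S, T]"
proof -
  have "T_gen S * T_gen T * T_gen S = T_gen T * T_gen S * T_gen T"
    by transfer (rule hecke_ideal.braid)
  then show ?thesis
    by (simp add: Tw_def mult.assoc)
qed

lemma hecke_cubic: "T_gen x ^ 3 = 1 + \<xi>\<^sub>1 \<odot> T_gen x + \<xi>\<^sub>2 \<odot> T_gen x ^ 2"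
  unfolding power2_eq_square power3_eq_cube
  by transfer (use hecke_ideal.cubic in \<open>simp add: power2_eq_square power3_eq_cube\<close>)

definition centralizer :: "hecke \<Rightarrow> hecke set"
  where "centralizer a = {x. x * a = a * x}"

text \<open>
  A list enumerates an \<open>R\<close>-basis of \<open>M\<close>. Distinctness is required separately because
  linear independence of a set does not see repetitions in the list.
\<close>

definition is_basis_of :: "hecke list \<Rightarrow> hecke set \<Rightarrow> bool"
  where "is_basis_of bs M \<longleftrightarrow>
    distinct bs \<and> hecke.independent (set bs) \<and> hecke.span (set bs) = M"

end

theory Submission
  imports Defs
begin

text \<open>
  Left multiplication by the two generators is written down as two explicit operators on
  \<open>R\<^bsup>24\<^esup>\<close>. They satisfy the braid and cubic relations, so they
  make \<open>R\<^bsup>24\<^esup>\<close> a module over the Hecke algebra, and acting on the first unit vector sends the words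
  of \<open>B\<^sub>s\<^sub>t\<^sub>s\<close> to the unit vectors; hence \<open>B\<^sub>s\<^sub>t\<^sub>s\<close> is independent. It spans because its span is
  stable under left multiplication by the generators. In the resulting coordinates, being
  centralized by \<open>T\<^sub>t\<close> is a system of 24 linear equations, and each of the twelve
  proposed elements has a basis word with coefficient 1 that occurs in none of the other eleven. So it
  is enough that a solution vanishing at these twelve words is zero.
\<close>

section \<open>Basis words and left multiplication by the generators in coordinates\<close>

datatype basis =
  W_1 | W_s | W_t | W_ss | W_tt | W_st | W_ts | W_stt | W_tts | W_sst | W_tss | W_sstt | W_ttss
  | W_stts | W_tsst | W_sstss | W_ttstt | W_ststst | W_sts | W_stss | W_ssts | W_sstts | W_sttss
  | W_ssttss

primrec word_of :: "basis \<Rightarrow> gen list" where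
  "word_of W_1 = []"
| "word_of W_s = [S]"
| "word_of W_t = [T]"
| "word_of W_ss = [S, S]"
| "word_of W_tt = [T, T]"
| "word_of W_st = [S, T]"
| "word_of W_ts = [T, S]"
| "word_of W_stt = [S, T, T]"
| "word_of W_tts = [T, T, S]"
| "word_of W_sst = [S, S, T]"
| "word_of W_tss = [T, S, S]"
| "word_of W_sstt = [S, S, T, T]"
| "word_of W_ttss = [T, T, S, S]"
| "word_of W_stts = [S, T, T, S]"
| "word_of W_tsst = [T, S, S, T]"
| "word_of W_sstss = [S, S, T, S, S]"
| "word_of W_ttstt = [T, T, S, T, T]"
| "word_of W_ststst = [S, T, S, T, S, T]"
| "word_of W_sts = [S, T, S]"
| "word_of W_stss = [S, T, S, S]"
| "word_of W_ssts = [S, S, T, S]"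
| "word_of W_sstts = [S, S, T, T, S]"
| "word_of W_sttss = [S, T, T, S, S]"
| "word_of W_ssttss = [S, S, T, T, S, S]"

text \<open>Literal reversal except at \<open>W_ststst\<close>, whose reversal \<open>tststs\<close>
  equals \<open>ststst\<close> by the braid relation.\<close>

primrec reversal :: "basis \<Rightarrow> basis" where
  "reversal W_1 = W_1"
| "reversal W_s = W_s"
| "reversal W_t = W_t"
| "reversal W_ss = W_ss"
| "reversal W_tt = W_tt"
| "reversal W_st = W_ts"
| "reversal W_ts = W_st"
| "reversal W_stt = W_tts"
| "reversal W_tts = W_stt"
| "reversal W_sst = W_tss"
| "reversal W_tss = W_sst"
| "reversal W_sstt = W_ttss"
| "reversal W_ttss = W_sstt"
| "reversal W_stts = W_stts"
| "reversal W_tsst = W_tsst"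
| "reversal W_sstss = W_sstss"
| "reversal W_ttstt = W_ttstt"
| "reversal W_ststst = W_ststst"
| "reversal W_sts = W_sts"
| "reversal W_stss = W_ssts"
| "reversal W_ssts = W_stss"
| "reversal W_sstts = W_sttss"
| "reversal W_sttss = W_sstts"
| "reversal W_ssttss = W_ssttss"

lemma UNIV_basis: "UNIV = {
  W_1, W_s, W_t, W_ss, W_tt, W_st, W_ts, W_stt, W_tts, W_sst, W_tss, W_sstt, W_ttss, W_stts,
  W_tsst, W_sstss, W_ttstt, W_ststst, W_sts, W_stss, W_ssts, W_sstts, W_sttss, W_ssttss}"
  by (auto intro: basis.exhaust)

lemma finite_basis [simp]: "finite (UNIV :: basis set)"
  by (simp add: UNIV_basis)

type_synonym vec = "basis \<Rightarrow> R"

definition unit_vec :: "basis \<Rightarrow> vec"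
  where "unit_vec b = (\<lambda>c. of_bool (c = b))"

text \<open>
  The coordinates of \<open>T\<^sub>s * x\<close> and \<open>T\<^sub>t * x\<close>, where \<open>v\<close> are those of \<open>x\<close>. Besides the cubic
  relations, the formulas come from \<open>t s t = s t s\<close>, \<open>s t s\<^sup>2 t = t\<^sup>2 s t\<^sup>2\<close>,
  \<open>s\<^sup>2 t s\<^sup>2 t = s t s t s t\<close>, \<open>t\<^sup>-\<^sup>1 s\<^sup>2 t = s t\<^sup>2 s\<^sup>-\<^sup>1\<close> and \<open>t s\<^sup>2 t\<^sup>-\<^sup>1 = s\<^sup>-\<^sup>1 t\<^sup>2 s\<close>.
\<close>

primrec mulS :: "vec \<Rightarrow> vec" where
  "mulS v W_1 = v W_ss"
| "mulS v W_s = v W_1 + \<xi>\<^sub>1 * v W_ss"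
| "mulS v W_t = v W_sst"
| "mulS v W_ss = v W_s + \<xi>\<^sub>2 * v W_ss"
| "mulS v W_tt = v W_sstt"
| "mulS v W_st = v W_t + \<xi>\<^sub>1 * v W_sst"
| "mulS v W_ts = v W_ssts"
| "mulS v W_stt = v W_tt + \<xi>\<^sub>1 * v W_sstt"
| "mulS v W_tts = v W_sstts"
| "mulS v W_sst = v W_st + \<xi>\<^sub>2 * v W_sst"
| "mulS v W_tss = v W_sstss"
| "mulS v W_sstt = v W_stt + \<xi>\<^sub>2 * v W_sstt"
| "mulS v W_ttss = v W_ssttss"
| "mulS v W_stts = v W_tts + \<xi>\<^sub>1 * v W_sstts"
| "mulS v W_tsst = v W_ststst"
| "mulS v W_sstss = \<xi>\<^sub>2 * v W_sstss + v W_stss"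
| "mulS v W_ttstt = v W_tsst + \<xi>\<^sub>1 * v W_ststst"
| "mulS v W_ststst = v W_ttstt + \<xi>\<^sub>2 * v W_ststst"
| "mulS v W_sts = v W_ts + \<xi>\<^sub>1 * v W_ssts"
| "mulS v W_stss = v W_tss + \<xi>\<^sub>1 * v W_sstss"
| "mulS v W_ssts = v W_sts + \<xi>\<^sub>2 * v W_ssts"
| "mulS v W_sstts = v W_stts + \<xi>\<^sub>2 * v W_sstts"
| "mulS v W_sttss = v W_ttss + \<xi>\<^sub>1 * v W_ssttss"
| "mulS v W_ssttss = v W_sttss + \<xi>\<^sub>2 * v W_ssttss"

primrec mulT :: "vec \<Rightarrow> vec" where
  "mulT v W_1 = v W_tt"
| "mulT v W_s = v W_tts"
| "mulT v W_t = v W_1 + \<xi>\<^sub>1 * v W_tt + \<xi>\<^sub>1 * v W_sstts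
      + \<xi>\<^sub>1 * \<xi>\<^sub>2 * v W_ssttss"
| "mulT v W_ss = v W_ttss"
| "mulT v W_tt = v W_t + \<xi>\<^sub>2 * v W_tt - \<xi>\<^sub>1 * v W_ssttss"
| "mulT v W_st = v W_stss"
| "mulT v W_ts = v W_s + \<xi>\<^sub>1 * v W_tts + \<xi>\<^sub>1^2 * v W_sstts
      + \<xi>\<^sub>1 * v W_ssttss + \<xi>\<^sub>1^2 * \<xi>\<^sub>2 * v W_ssttss"
| "mulT v W_stt = v W_ttstt - \<xi>\<^sub>1 * v W_tsst - \<xi>\<^sub>2 * v W_ssttss"
| "mulT v W_tts = v W_ts + \<xi>\<^sub>2 * v W_tts - \<xi>\<^sub>1 * v W_sstt
      - \<xi>\<^sub>1^2 * v W_ssttss"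
| "mulT v W_sst = \<xi>\<^sub>1 * v W_tsst + v W_sttss"
| "mulT v W_tss = v W_ss + \<xi>\<^sub>1 * v W_sstt + \<xi>\<^sub>1 * v W_ttss
      + \<xi>\<^sub>1 * \<xi>\<^sub>2 * v W_sstts
      + \<xi>\<^sub>1 * \<xi>\<^sub>2^2 * v W_ssttss + \<xi>\<^sub>1^2 * v W_ssttss"
| "mulT v W_sstt = v W_ssttss"
| "mulT v W_ttss = v W_tss + \<xi>\<^sub>2 * v W_ttss - \<xi>\<^sub>1 * v W_sstts
      - \<xi>\<^sub>1 * \<xi>\<^sub>2 * v W_ssttss"
| "mulT v W_stts = v W_ststst - \<xi>\<^sub>2 * v W_sstt - \<xi>\<^sub>2 * v W_tsst
      - \<xi>\<^sub>1 * \<xi>\<^sub>2 * v W_ssttss"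
| "mulT v W_tsst = v W_sst + \<xi>\<^sub>2 * v W_sstt + \<xi>\<^sub>2 * v W_tsst"
| "mulT v W_sstss = v W_stts + \<xi>\<^sub>1 * v W_ststst + \<xi>\<^sub>2 * v W_sttss"
| "mulT v W_ttstt = \<xi>\<^sub>2 * v W_ttstt + v W_ssts + \<xi>\<^sub>2 * v W_sstts"
| "mulT v W_ststst = v W_sstss + \<xi>\<^sub>2 * v W_ststst + \<xi>\<^sub>2 * v W_ssttss"
| "mulT v W_sts = v W_st + \<xi>\<^sub>1 * v W_stss"
| "mulT v W_stss = v W_sts + \<xi>\<^sub>2 * v W_stss"
| "mulT v W_ssts = v W_stt + \<xi>\<^sub>1 * v W_ttstt + \<xi>\<^sub>1 * v W_sttss"
| "mulT v W_sstts = v W_sstt + \<xi>\<^sub>1 * v W_ssttss"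
| "mulT v W_sttss = v W_tsst - \<xi>\<^sub>2 * v W_sstts - \<xi>\<^sub>2^2 * v W_ssttss"
| "mulT v W_ssttss = v W_sstts + \<xi>\<^sub>2 * v W_ssttss"

text \<open>Reversing words is an anti-automorphism that permutes \<open>B\<^sub>s\<^sub>t\<^sub>s\<close>.\<close>

definition mulT_right :: "vec \<Rightarrow> vec"
  where "mulT_right v = (\<lambda>b. mulT (\<lambda>c. v (reversal c)) (reversal b))"

primrec mul :: "gen \<Rightarrow> vec \<Rightarrow> vec" where
  "mul S = mulS"
| "mul T = mulT"

lemma mul_braid: "mulS (mulT (mulS v)) = mulT (mulS (mulT v))"
proof
  fix b show "mulS (mulT (mulS v)) b = mulT (mulS (mulT v)) b"
    by (cases b) (simp_all add: algebra_simps power2_eq_square)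
qed

lemma mul_cubic: "mul x (mul x (mul x v)) = (\<lambda>b. v b + \<xi>\<^sub>1 * mul x v b + \<xi>\<^sub>2 * mul x (mul x v) b)"
proof
  fix b show "mul x (mul x (mul x v)) b = v b + \<xi>\<^sub>1 * mul x v b + \<xi>\<^sub>2 * mul x (mul x v) b"
    by (cases x; cases b) (simp_all add: algebra_simps power2_eq_square)
qed

lemma mul_add: "mul x (\<lambda>b. u b + v b) = (\<lambda>b. mul x u b + mul x v b)"
proof
  fix b show "mul x (\<lambda>b. u b + v b) b = mul x u b + mul x v b"
    by (cases x; cases b) (simp_all add: algebra_simps)
qed

lemma mul_scale: "mul x (\<lambda>b. r * v b) = (\<lambda>b. r * mul x v b)"
proof
  fix b show "mul x (\<lambda>b. r * v b) b = r * mul x v b"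
    by (cases x; cases b) (simp_all add: algebra_simps)
qed

text \<open>Associativity \<open>(x y) t = x (y t)\<close>, seen in coordinates.\<close>

lemma mulT_right_mul: "mulT_right (mul x v) = mul x (mulT_right v)"
proof
  fix b show "mulT_right (mul x v) b = mul x (mulT_right v) b"
    by (cases x; cases b) (simp_all add: mulT_right_def algebra_simps power2_eq_square)
qed


section \<open>Action of the free algebra and coordinates on the quotient\<close>

definition act :: "free_alg \<Rightarrow> vec \<Rightarrow> vec"
  where "act a v = (\<lambda>b. \<Sum>w\<in>Poly_Mapping.keys a. Poly_Mapping.lookup a w * foldr mul (letters w) v b)"

lemma act_single: "act (Poly_Mapping.single w r) v = (\<lambda>b. r * foldr mul (letters w) v b)"
  by (simp add: act_def)

lemma act_add: "act (a + a') v = (\<lambda>b. act a v b + act a' v b)"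
  unfolding act_def by (rule ext, rule setsum_keys_plus_distrib) (simp_all add: distrib_right)

lemma act_zero: "act 0 v = (\<lambda>b. 0)"
  by (simp add: act_def)

lemma act_diff: "act (a - a') v = (\<lambda>b. act a v b - act a' v b)"
  using act_add[of "a - a'" a' v] by (auto simp: fun_eq_iff)

lemma act_const: "act (const r) v = (\<lambda>b. r * v b)"
  by (simp add: const_def act_single zero_word_def)

lemma act_one: "act 1 v = v"
  using act_const[of 1] by simp

lemma act_var: "act (var x) v = mul x v"
  by (simp add: var_def act_single)

lemma foldr_mul_add:
  "foldr mul xs (\<lambda>b. u b + v b) = (\<lambda>b. foldr mul xs u b + foldr mul xs v b)"
  by (induction xs) (simp_all add: mul_add)

lemma foldr_mul_scale: "foldr mul xs (\<lambda>b. r * v b) = (\<lambda>b. r * foldr mul xs v b)"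
  by (induction xs) (simp_all add: mul_scale)

lemma foldr_mul_mulT_right: "foldr mul xs (mulT_right v) = mulT_right (foldr mul xs v)"
  by (induction xs) (simp_all add: mulT_right_mul)

lemma mulT_right_add: "mulT_right (\<lambda>b. u b + v b) = (\<lambda>b. mulT_right u b + mulT_right v b)"
  using mul_add[of T] by (simp add: mulT_right_def)

lemma mulT_right_scale: "mulT_right (\<lambda>b. r * v b) = (\<lambda>b. r * mulT_right v b)"
  using mul_scale[of T] by (simp add: mulT_right_def)

lemma act_mulT_right: "act a (mulT_right v) = mulT_right (act a v)"
proof (induction a rule: free_alg_induct)
  case (single w r)
  then show ?case by (simp add: act_single foldr_mul_mulT_right mulT_right_scale)
next
  case (add a a')
  then show ?case by (simp add: act_add mulT_right_add)
qed

lemma act_mult: "act (a * a') v = act a (act a' v)"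
proof (induction a rule: free_alg_induct)
  case (single w r)
  show ?case
  proof (induction a' rule: free_alg_induct)
    case (single w' r')
    show ?case
      by (simp add: mult_single act_single foldr_mul_scale plus_word_def mult.assoc)
  next
    case (add a b)
    then show ?case by (simp add: distrib_left act_add act_single foldr_mul_add)
  qed
next
  case (add a b)
  then show ?case by (simp add: distrib_right act_add)
qed

text \<open>The vector stays arbitrary in the induction because in \<open>a * b\<close> the factor
  \<open>a\<close> is applied to \<open>act b v\<close>.\<close>

lemma act_hecke_ideal: "a \<in> hecke_ideal \<Longrightarrow> act a v = (\<lambda>b. 0)"
proof (induction arbitrary: v rule: hecke_ideal.induct)
  case braid
  show ?case by (simp add: act_diff act_mult act_var mul_braid)
next
  case (cubic x)
  show ?case
    by (simp add: act_diff act_add act_mult act_var act_const act_one mul_cubic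
        power2_eq_square power3_eq_cube)
next
  case (mult_left a b)
  have "act b (\<lambda>b. 0) = (\<lambda>b. 0)"
    using foldr_mul_scale[of _ 0 "\<lambda>b. 0"] by (simp add: act_def)
  then show ?case using mult_left by (simp add: act_mult)
qed (simp_all add: act_zero act_add act_mult)

text \<open>The orbit map of the unit vector at the empty word; \<open>coord_Tw_word_of\<close>
  identifies it as coordinates with respect to the 24 words.\<close>

lift_definition coord :: "hecke \<Rightarrow> vec" is "\<lambda>a. act a (unit_vec W_1)"
proof -
  fix a a' :: free_alg
  assume "a - a' \<in> hecke_ideal"
  from act_hecke_ideal[OF this] show "act a (unit_vec W_1) = act a' (unit_vec W_1)"
    by (simp add: act_diff fun_eq_iff)
qed

lemma coord_0: "coord 0 = (\<lambda>b. 0)"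
  by transfer (rule act_zero)

lemma coord_add: "coord (x + y) = (\<lambda>b. coord x b + coord y b)"
  by transfer (rule act_add)

lemma coord_diff: "coord (x - y) = (\<lambda>b. coord x b - coord y b)"
  by transfer (rule act_diff)

lemma coord_scale: "coord (r \<odot> x) = (\<lambda>b. r * coord x b)"
  by transfer (simp add: act_mult act_const)

lemma coord_sum: "coord (sum f A) b = (\<Sum>i\<in>A. coord (f i) b)"
  by (induction A rule: infinite_finite_induct) (simp_all add: coord_0 coord_add)

lemma coord_T_gen_mult: "coord (T_gen x * y) = mul x (coord y)"
  by transfer (simp add: act_mult act_var)

text \<open>The action of the algebra commutes with \<open>mulT_right\<close>, so it suffices that
  \<open>mulT\<close> and \<open>mulT_right\<close> agree on the unit vector at the empty
  word.\<close>

lemma coord_mult_T_gen_T: "coord (y * T_gen T) = mulT_right (coord y)"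
proof transfer
  fix a
  have "mulT (unit_vec W_1) b = mulT_right (unit_vec W_1) b" for b
    by (cases b) (simp_all add: mulT_right_def unit_vec_def)
  then have "act (var T) (unit_vec W_1) = mulT_right (unit_vec W_1)"
    by (simp add: act_var fun_eq_iff)
  then show "act (a * var T) (unit_vec W_1) = mulT_right (act a (unit_vec W_1))"
    by (simp add: act_mult act_mulT_right)
qed

lemma Tw_Nil: "Tw [] = 1"
  and Tw_Cons: "Tw (x # w) = T_gen x * Tw w"
  by (simp_all add: Tw_def)

lemma coord_Tw_Nil: "coord (Tw []) = unit_vec W_1"
  unfolding Tw_Nil by transfer (rule act_one)

lemma coord_Tw_word_of: "coord (Tw (word_of b)) = unit_vec b"
proof
  fix c show "coord (Tw (word_of b)) c = unit_vec b c"
    by (cases c; cases b) (simp_all add: Tw_Cons coord_T_gen_mult coord_Tw_Nil unit_vec_def)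
qed

section \<open>Rewriting rules for words, and spanning\<close>

text \<open>The trailing factor \<open>y\<close> lets the relation rewrite at any position of a
  right-nested product.\<close>

lemma T_gen_cubic:
  "T_gen x * (T_gen x * (T_gen x * y)) = y + \<xi>\<^sub>1 \<odot> (T_gen x * y) + \<xi>\<^sub>2 \<odot> (T_gen x * (T_gen x * y))"
  using arg_cong[OF hecke_cubic, of "\<lambda>z. z * y" x]
  by (simp add: power2_eq_square power3_eq_cube distrib_right scale_mult_left mult.assoc)

lemma T_gen_braid: "T_gen T * (T_gen S * (T_gen T * y)) = T_gen S * (T_gen T * (T_gen S * y))"
  using arg_cong[OF hecke_braid, of "\<lambda>z. z * y"] by (simp add: Tw_def mult.assoc)

text \<open>By the cubic relation \<open>s\<close> is invertible, with inverse
  \<open>s^2 - \<xi>\<^sub>2 s - \<xi>\<^sub>1\<close>.\<close>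

lemma T_gen_S_cancel: "T_gen S * y = T_gen S * z \<Longrightarrow> y = z"
proof -
  assume eq: "T_gen S * y = T_gen S * z"
  have inv: "T_gen S * (T_gen S * (T_gen S * w)) - \<xi>\<^sub>1 \<odot> (T_gen S * w)
      - \<xi>\<^sub>2 \<odot> (T_gen S * (T_gen S * w)) = w" for w
    by (simp add: T_gen_cubic)
  show "y = z"
    using inv[of y, unfolded eq] inv[of z] by (rule trans[OF sym])
qed

text \<open>Both words equal \<open>tstst\<close> by one braid move.\<close>

lemma T_gen_TSSTS:
  "T_gen T * (T_gen S * (T_gen S * (T_gen T * (T_gen S * y)))) =
   T_gen S * (T_gen T * (T_gen S * (T_gen S * (T_gen T * y))))"
  by (simp add: T_gen_braid[symmetric])

lemmas scale_simps = distrib_left right_diff_distrib scale_mult_right hecke.scale_right_distrib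
  hecke.scale_right_diff_distrib

text \<open>For \<open>x = s y\<close>, braid moves turn \<open>t^2 s^2 t s\<close> into
  \<open>s t s^3 t\<close>, where the cubic relation applies.\<close>

lemma T_gen_TTSST:
  "T_gen T * (T_gen T * (T_gen S * (T_gen S * (T_gen T * x)))) =
   T_gen S * (T_gen T * (T_gen T * (T_gen S * (T_gen S * x))))
   - \<xi>\<^sub>2 \<odot> (T_gen S * (T_gen T * (T_gen T * (T_gen S * x))))
   - \<xi>\<^sub>1 \<odot> (T_gen S * (T_gen T * (T_gen T * x)))
   + \<xi>\<^sub>1 \<odot> (T_gen S * (T_gen S * (T_gen T * x)))
   + \<xi>\<^sub>2 \<odot> (T_gen T * (T_gen S * (T_gen S * (T_gen T * x))))"
proof -
  let ?a = "T_gen S" and ?b = "T_gen T"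
  \<comment> \<open>This is \<open>s^-1 x\<close>, written out by means of the cubic
    relation.\<close>
  define y where "y = ?a * (?a * x) - \<xi>\<^sub>2 \<odot> (?a * x) - \<xi>\<^sub>1 \<odot> x"
  have x: "?a * y = x"
    by (simp add: y_def scale_simps T_gen_cubic)
  have "?b * (?b * (?a * (?a * (?b * (?a * y))))) = ?b * (?b * (?a * (?b * (?a * (?b * y)))))"
    by (simp only: T_gen_braid)
  also have "\<dots> = ?a * (?b * (?a * (?a * (?a * (?b * y)))))"
    by (simp only: T_gen_braid[of "?a * (?b * y)"] T_gen_braid[of "?a * (?a * (?b * y))"])
  also have "\<dots> = ?a * (?b * (?b * y)) + \<xi>\<^sub>1 \<odot> (?a * (?a * (?b * (?a * y))))
      + \<xi>\<^sub>2 \<odot> (?b * (?a * (?a * (?b * (?a * y)))))"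
    by (simp add: T_gen_cubic T_gen_TSSTS scale_simps T_gen_braid)
  finally have "?b * (?b * (?a * (?a * (?b * x)))) = ?a * (?b * (?b * y))
      + \<xi>\<^sub>1 \<odot> (?a * (?a * (?b * x))) + \<xi>\<^sub>2 \<odot> (?b * (?a * (?a * (?b * x))))"
    by (simp only: x)
  then show ?thesis
    by (simp add: y_def scale_simps)
qed

text \<open>After left multiplication by \<open>s\<close>, braid moves lead to
  \<open>t s^3 t s\<close>, where the cubic relation applies; then \<open>s\<close> is
  cancelled.\<close>

lemma T_gen_TSSTT:
  "T_gen T * (T_gen S * (T_gen S * (T_gen T * (T_gen T * x)))) =
   T_gen S * (T_gen S * (T_gen T * (T_gen T * (T_gen S * x))))
   - \<xi>\<^sub>2 \<odot> (T_gen S * (T_gen T * (T_gen T * (T_gen S * x))))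
   - \<xi>\<^sub>1 \<odot> (T_gen T * (T_gen T * (T_gen S * x)))
   + \<xi>\<^sub>1 \<odot> (T_gen T * (T_gen S * (T_gen S * x)))
   + \<xi>\<^sub>2 \<odot> (T_gen T * (T_gen S * (T_gen S * (T_gen T * x))))"
proof (rule T_gen_S_cancel)
  let ?a = "T_gen S" and ?b = "T_gen T"
  have "?a * (?b * (?a * (?a * (?b * (?b * x))))) = ?b * (?a * (?b * (?a * (?b * (?b * x)))))"
    by (simp only: T_gen_braid[of "?a * (?b * (?b * x))"])
  also have "\<dots> = ?b * (?a * (?a * (?a * (?b * (?a * x)))))"
    by (simp only: T_gen_braid[of "?b * x"] T_gen_braid[of x])
  also have "\<dots> = ?b * (?b * (?a * x)) + \<xi>\<^sub>1 \<odot> (?a * (?b * (?a * (?a * x))))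
      + \<xi>\<^sub>2 \<odot> (?a * (?b * (?a * (?a * (?b * x)))))"
    by (simp add: T_gen_cubic T_gen_TSSTS scale_simps T_gen_braid)
  finally show "?a * (?b * (?a * (?a * (?b * (?b * x))))) =
      ?a * (?a * (?a * (?b * (?b * (?a * x)))) - \<xi>\<^sub>2 \<odot> (?a * (?b * (?b * (?a * x))))
      - \<xi>\<^sub>1 \<odot> (?b * (?b * (?a * x))) + \<xi>\<^sub>1 \<odot> (?b * (?a * (?a * x)))
      + \<xi>\<^sub>2 \<odot> (?b * (?a * (?a * (?b * x)))))"
    by (simp add: T_gen_cubic scale_simps)
qed

definition Tw_span :: "hecke set"
  where "Tw_span = hecke.span (range (\<lambda>b. Tw (word_of b)))"

lemma Tw_word_of_in_span: "Tw (word_of b) \<in> Tw_span"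
  unfolding Tw_span_def by (rule hecke.span_base) simp

lemma Tw_span_add: "x \<in> Tw_span \<Longrightarrow> y \<in> Tw_span \<Longrightarrow> x + y \<in> Tw_span"
    and Tw_span_diff: "x \<in> Tw_span \<Longrightarrow> y \<in> Tw_span \<Longrightarrow> x - y \<in> Tw_span"
    and Tw_span_scale: "x \<in> Tw_span \<Longrightarrow> r \<odot> x \<in> Tw_span"
  by (simp_all add: Tw_span_def hecke.span_add hecke.span_diff hecke.span_scale)

lemma T_gen_mult_word_of_in_span: "T_gen x * Tw (word_of b) \<in> Tw_span"
proof -
  \<comment> \<open>These rules terminate in words of \<open>B\<^sub>s\<^sub>t\<^sub>s\<close>, up to rewriting the latter in the same way:
    \<open>t\<^sup>2 s t\<^sup>2\<close> turns into \<open>s t s\<^sup>2 t\<close> and \<open>s t s t s t\<close> into \<open>s\<^sup>2 t s\<^sup>2 t\<close>.\<close>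
  note normalize = word_of.simps Tw_Cons T_gen_cubic T_gen_braid T_gen_TSSTS T_gen_TTSST T_gen_TSSTT
    scale_simps
  have "\<forall>c\<in>UNIV. Tw (word_of c) \<in> Tw_span"
    by (simp add: Tw_word_of_in_span)
  note words = this[unfolded UNIV_basis ball_simps(5,7) normalize]
  show ?thesis
    by (cases x; cases b; simp only: normalize;
        (intro Tw_span_add Tw_span_diff Tw_span_scale)?; simp only: words)
qed

text \<open>Stability under left multiplication puts every word into the span, and each element of
  the quotient is a sum of classes of monomials, which are multiples of words.\<close>

lemma Tw_span_eq_UNIV: "Tw_span = UNIV"
proof -
  have closed: "T_gen x * y \<in> Tw_span" if "y \<in> Tw_span" for x y
    using that[unfolded Tw_span_def]
  proof (induction rule: hecke.span_induct_alt)
    case base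
    then show ?case by (simp add: Tw_span_def hecke.span_zero)
  next
    case (step c y z)
    then obtain b where "y = Tw (word_of b)" by auto
    with step show ?case
      by (auto simp: distrib_left scale_mult_right
          intro!: Tw_span_add Tw_span_scale T_gen_mult_word_of_in_span)
  qed
  have Tw: "Tw w \<in> Tw_span" for w
    using Tw_word_of_in_span[of W_1] by (induction w) (simp_all add: Tw_Cons closed)
  have "abs_hecke a \<in> Tw_span" for a
  proof (induction a rule: free_alg_induct)
    case (single w r)
    have "abs_hecke (Poly_Mapping.single (Word xs) r) = r \<odot> Tw xs" for xs
    proof (induction xs)
      case Nil
      show ?case
        by (simp add: Tw_Nil one_hecke_def scale.abs_eq const_def zero_word_def)
    next
      case (Cons x xs)
      have "Poly_Mapping.single (Word (x # xs)) r = var x * Poly_Mapping.single (Word xs) r"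
        by (simp add: var_def mult_single plus_word_def)
      then have "abs_hecke (Poly_Mapping.single (Word (x # xs)) r)
          = T_gen x * abs_hecke (Poly_Mapping.single (Word xs) r)"
        by (simp add: T_gen_def times_hecke.abs_eq)
      then show ?case
        by (simp add: Cons Tw_Cons scale_mult_right)
    qed
    from this[of "letters w"] show ?case
      by (simp add: Tw Tw_span_scale)
  next
    case (add a a')
    then show ?case
      by (simp add: plus_hecke.abs_eq[symmetric] Tw_span_add)
  qed
  then have "x \<in> Tw_span" for x
    by (induction x rule: hecke.abs_induct)
  then show ?thesis by auto
qed

text \<open>Both sides are linear in \<open>x\<close>, so it is enough to compare them on the
  spanning words, whose coordinates are unit vectors.\<close>

lemma expand_coord: "x = (\<Sum>b\<in>UNIV. coord x b \<odot> Tw (word_of b))"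
proof -
  have "x \<in> hecke.span (range (\<lambda>b. Tw (word_of b)))"
    using Tw_span_eq_UNIV by (simp add: Tw_span_def)
  then show ?thesis
  proof (induction rule: hecke.span_induct_alt)
    case base
    show ?case by (simp add: coord_0)
  next
    case (step r y z)
    then obtain b where y: "y = Tw (word_of b)" by auto
    have y_sum: "y = (\<Sum>c\<in>UNIV. coord y c \<odot> Tw (word_of c))"
      by (simp add: y coord_Tw_word_of unit_vec_def of_bool_def if_distrib[of "\<lambda>r. r \<odot> _"]
          cong: if_cong)
    have "(\<Sum>c\<in>UNIV. coord (r \<odot> y + z) c \<odot> Tw (word_of c))
        = r \<odot> (\<Sum>c\<in>UNIV. coord y c \<odot> Tw (word_of c)) + (\<Sum>c\<in>UNIV. coord z c \<odot> Tw (word_of c))"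
      by (simp add: coord_add coord_scale hecke.scale_left_distrib sum.distrib hecke.scale_sum_right)
    then show ?case
      by (simp only: y_sum[symmetric] step.IH[symmetric])
  qed
qed

lemma coord_eqI: "(\<And>b. coord x b = coord y b) \<Longrightarrow> x = y"
  using expand_coord[of x] expand_coord[of y] by simp

section \<open>A basis criterion through pivot coordinates\<close>

text \<open>By \<open>dual_list\<close> the pivot coordinates are dual to the list
  \<open>xs\<close>. They read off the coefficients of a linear relation, which gives
  independence.\<close>

lemma is_basis_of_pivots:
  assumes len: "length ps = length xs"
    and dual_list: "map (\<lambda>x. map (coord x) ps) xs =
      map (\<lambda>i. map (\<lambda>j. of_bool (i = j)) [0..<length xs]) [0..<length xs]"
    and sub: "hecke.subspace M" "set xs \<subseteq> M"
    and zero: "\<And>x. x \<in> M \<Longrightarrow> (\<And>p. p \<in> set ps \<Longrightarrow> coord x p = 0) \<Longrightarrow> x = 0"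
  shows "is_basis_of xs M"
proof -
  have dual: "coord (xs ! i) (ps ! j) = of_bool (i = j)" if "i < length xs" "j < length xs" for i j
    using arg_cong[OF dual_list, of "\<lambda>rows. rows ! i ! j"] that len by simp
  have distinct: "distinct xs"
    unfolding distinct_conv_nth
  proof (intro allI impI notI)
    fix i j assume "i < length xs" "j < length xs" "i \<noteq> j" "xs ! i = xs ! j"
    then show False using dual[of i j] dual[of j j] by simp
  qed
  have "\<not> hecke.dependent (set xs)"
  proof
    assume "hecke.dependent (set xs)"
    then obtain A u v where A: "finite A" "A \<subseteq> set xs" and sum: "(\<Sum>w\<in>A. u w \<odot> w) = 0"
      and v: "v \<in> A" "u v \<noteq> 0"
      by (auto simp: hecke.dependent_explicit)
    from v A obtain i where i: "i < length xs" "v = xs ! i"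
      by (metis in_set_conv_nth subsetD)
    have "coord w (ps ! i) = of_bool (w = v)" if "w \<in> A" for w
      using that A i dual distinct by (auto simp: in_set_conv_nth nth_eq_iff_index_eq dest!: subsetD)
    then have "coord (\<Sum>w\<in>A. u w \<odot> w) (ps ! i) = (\<Sum>w\<in>A. u w * of_bool (w = v))"
      by (simp add: coord_sum coord_scale)
    also have "\<dots> = u v"
      using A v by simp
    finally show False
      using sum v by (simp add: coord_0)
  qed
  moreover have "M \<subseteq> hecke.span (set xs)"
  proof
    fix x assume x: "x \<in> M"
    \<comment> \<open>The combination prescribed by the pivot coordinates of \<open>x\<close>; the
      difference \<open>x - y\<close> lies in \<open>M\<close> and vanishes at every pivot.\<close>
    define y where "y = (\<Sum>i<length xs. coord x (ps ! i) \<odot> xs ! i)"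
    have y: "y \<in> hecke.span (set xs)"
      unfolding y_def by (intro hecke.span_sum hecke.span_scale hecke.span_base) simp
    then have "y \<in> M"
      using hecke.span_minimal[OF sub(2,1)] by blast
    with x have "x - y \<in> M"
      by (simp add: sub hecke.subspace_diff)
    moreover have "coord (x - y) p = 0" if p: "p \<in> set ps" for p
    proof -
      from p obtain j where j: "j < length xs" "p = ps ! j"
        by (metis in_set_conv_nth len)
      have "coord y p = (\<Sum>i<length xs. coord x (ps ! i) * of_bool (i = j))"
        using j by (simp add: y_def coord_sum coord_scale dual)
      also have "\<dots> = coord x p"
        using j by simp
      finally show ?thesis by (simp add: coord_diff)
    qed
    ultimately have "x - y = 0"
      by (rule zero)
    with y show "x \<in> hecke.span (set xs)" by simp
  qed
  ultimately show ?thesis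
    using distinct hecke.span_minimal[OF sub(2,1)] by (auto simp: is_basis_of_def)
qed

section \<open>The centralizer as a linear system\<close>

lemma subspace_centralizer: "hecke.subspace (centralizer a)"
  by (auto simp: hecke.subspace_def centralizer_def distrib_left distrib_right
      scale_mult_left scale_mult_right)

text \<open>Coordinates determine an element. The quantifier is bounded by \<open>UNIV\<close> so
  that it can be unfolded into 24 equations.\<close>

lemma centralizer_T_iff:
  "x \<in> centralizer (Tw [T]) \<longleftrightarrow> (\<forall>b\<in>UNIV. mulT_right (coord x) b = mulT (coord x) b)"
proof -
  have "x * T_gen T = T_gen T * x \<longleftrightarrow> coord (x * T_gen T) = coord (T_gen T * x)"
    using coord_eqI by metis
  then show ?thesis
    by (simp add: centralizer_def Tw_def coord_mult_T_gen_T coord_T_gen_mult fun_eq_iff)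
qed

text \<open>The \<open>i\<close>-th word occurs with coefficient 1 in the \<open>i\<close>-th element of the proposed basis, and in no other.\<close>

definition pivots :: "basis list"
  where "pivots = [W_1, W_stts, W_t, W_sstss, W_tt, W_ststst,
    W_s, W_ts, W_tts, W_ss, W_ssttss, W_ttss]"

text \<open>Elimination of the twelve remaining unknowns, ordered so that each is solved for with
  coefficient 1; no division in \<open>R\<close> occurs.\<close>

lemma mulT_right_eq_mulT_zero:
  assumes comm: "\<And>b. mulT_right v b = mulT v b"
    and "\<And>p. p \<in> set pivots \<Longrightarrow> v p = 0"
  shows "v b = 0"
proof -
  have pivots [simp]: "v W_1 = 0" "v W_stts = 0" "v W_t = 0" "v W_sstss = 0" "v W_tt = 0"
    "v W_ststst = 0" "v W_s = 0" "v W_ts = 0" "v W_tts = 0" "v W_ss = 0" "v W_ssttss = 0"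
    "v W_ttss = 0"
    using assms(2) by (simp_all add: pivots_def)
  note comm = comm[unfolded mulT_right_def]
  have [simp]: "v W_stt = 0" using comm[of W_s] by simp
  have [simp]: "v W_sstt = 0" using comm[of W_ss] by simp
  have sstts: "v W_sstts = v W_sttss" using comm[of W_ssttss] by simp
  have tsst: "v W_tsst = \<xi>\<^sub>2 * v W_sttss" using comm[of W_sttss] by (simp add: sstts)
  \<comment> \<open>After substitution both sides contain
    \<open>\<xi>\<^sub>1 * \<xi>\<^sub>2 * v W_sttss\<close>; cancelling it leaves
    \<open>v W_sttss = 0\<close>.\<close>
  have [simp]: "v W_sttss = 0" using comm[of W_sst] by (simp add: tsst sstts algebra_simps)
  have [simp]: "v W_sstts = 0" "v W_tsst = 0" using sstts tsst by simp_all
  have [simp]: "v W_sst = 0" using comm[of W_sstt] by simp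
  have [simp]: "v W_tss = 0" using comm[of W_ttss] by simp
  have [simp]: "v W_stss = 0" using comm[of W_st] by simp
  have [simp]: "v W_ssts = 0" using comm[of W_ts] by simp
  have [simp]: "v W_st = 0" using comm[of W_sts] by simp
  have [simp]: "v W_ttstt = 0" using comm[of W_stt] by simp
  have [simp]: "v W_sts = 0" using comm[of W_stss] by simp
  show ?thesis by (cases b) simp_all
qed

theorem proposition3p6:
  shows "is_basis_of [
    Tw [],
    Tw [S,T,T,S],
    Tw [T],
    Tw [S,S,T,S,S],
    Tw [T,T],
    Tw [S,T,S,T,S,T],
    Tw [S] + Tw [S,T,S,S] + Tw [S,S,T,S] - \<xi>\<^sub>2 \<odot> Tw [S,T,S],
    Tw [T,S] + Tw [S,T] + Tw [T,T,S,T,T] + \<xi>\<^sub>1 \<odot> Tw [S,T,S],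
    Tw [T,T,S] + Tw [S,T,T] + Tw [S,T,S] + \<xi>\<^sub>1 \<odot> Tw [S,T,S,S] + \<xi>\<^sub>1 \<odot> Tw [S,S,T,S]
      + \<xi>\<^sub>2 \<odot> Tw [T,T,S,T,T],
    Tw [S,S] + Tw [S,T,T,S,S] + Tw [S,S,T,T,S] + \<xi>\<^sub>1 \<odot> Tw [S,T,S] + \<xi>\<^sub>2 \<odot> Tw [T,S,S,T]
      + (\<xi>\<^sub>1 * \<xi>\<^sub>2) \<odot> Tw [T,T,S,T,T] + \<xi>\<^sub>1 \<odot> (Tw [S,S,T] + Tw [T,S,S])
      + \<xi>\<^sub>1^2 \<odot> (Tw [S,T,S,S] + Tw [S,S,T,S]),
    Tw [T,S,S] + Tw [S,S,T] + Tw [S,S,T,T,S,S] + (\<xi>\<^sub>1 * \<xi>\<^sub>2) \<odot> (Tw [S,S,T] + Tw [T,S,S])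
      + (\<xi>\<^sub>1 + \<xi>\<^sub>2^2) \<odot> Tw [T,S,S,T] + (\<xi>\<^sub>2 * (1 + \<xi>\<^sub>1 * \<xi>\<^sub>2)) \<odot> Tw [T,T,S,T,T]
      + (\<xi>\<^sub>1 * (1 + \<xi>\<^sub>1 * \<xi>\<^sub>2)) \<odot> (Tw [S,T,S,S] + Tw [S,S,T,S]),
    Tw [T,T,S,S] + Tw [S,S,T,T] + Tw [T,S,S,T] + (\<xi>\<^sub>1 * \<xi>\<^sub>2) \<odot> Tw [T,S,S,T]
      + (\<xi>\<^sub>1^2 * \<xi>\<^sub>2) \<odot> Tw [T,T,S,T,T] + \<xi>\<^sub>1^2 \<odot> Tw [S,T,S]
      + (\<xi>\<^sub>1^2 - \<xi>\<^sub>2) \<odot> (Tw [S,S,T] + Tw [T,S,S])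
      + \<xi>\<^sub>1^3 \<odot> (Tw [S,T,S,S] + Tw [S,S,T,S])
      + \<xi>\<^sub>1 \<odot> (Tw [S,T,T,S,S] + Tw [S,S,T,T,S]) ]
    (centralizer (Tw [T]))"
proof (rule is_basis_of_pivots[where ps = pivots, OF _ _ subspace_centralizer])
  let "is_basis_of ?xs _" = ?thesis
  have "\<forall>b\<in>UNIV. coord (Tw (word_of b)) = unit_vec b"
    by (simp add: coord_Tw_word_of)
  note words = this[unfolded UNIV_basis ball_simps(5,7) word_of.simps]
  note coords = words coord_add coord_diff coord_scale unit_vec_def
  show "map (\<lambda>x. map (coord x) pivots) ?xs =
      map (\<lambda>i. map (\<lambda>j. of_bool (i = j)) [0..<length ?xs]) [0..<length ?xs]"
    by (simp add: pivots_def coords upt_conv_Cons)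
  show "set ?xs \<subseteq> centralizer (Tw [T])"
    \<comment> \<open>For each of the twelve elements, membership becomes 24 polynomial identities
      in \<open>\<xi>\<^sub>1\<close> and \<open>\<xi>\<^sub>2\<close>.\<close>
    unfolding list.set insert_subset centralizer_T_iff UNIV_basis ball_simps(5,7)
    by (simp add: coords mulT_right_def algebra_simps power2_eq_square power3_eq_cube)
  show "x = 0" if "x \<in> centralizer (Tw [T])" "\<And>p. p \<in> set pivots \<Longrightarrow> coord x p = 0" for x
    using that mulT_right_eq_mulT_zero[of "coord x"]
    by (intro coord_eqI) (simp add: centralizer_T_iff coord_0)
qed (simp add: pivots_def)

end
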